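(* Let $\gamma_{12},\gamma_{13},\gamma_{23}\in[0,\pi/2]$ and let $J_{12}(\gamma_{12}), J_{13}(\gamma_{13}), J_{23}(\gamma_{23})\in \mathrm{QRA}(3)$ be the pairwise entanglement gates on three qubits defined in the context. Then the pairwise entanglement gate $\hat J_2(\gamma_{12},\gamma_{13},\gamma_{23})$ is represented by the same element of $\mathrm{QRA}(3)$ for every possible ordering of the three entanglement gates; that is, all six products of the three elements $J_{12}(\gamma_{12}), J_{13}(\gamma_{13}), J_{23}(\gamma_{23})$, each taken once, in any order, are equal in $\mathrm{QRA}(3)$.
   Context: Quantum Register Algebra. Let $\mathbb G_{2n+2}$ be the real Clifford (geometric) algebra of positive definite signature with generators $e_1,\dots,e_{2n},r_1,r_2$ (each squares to $1$, distinct ones anticommute), let $\iota=r_1r_2$ (so $\iota^2=-1$ and $\iota$ commutes with every $e_j$), and let $\tilde{\mathbb C}=\{a+b\iota : a,b\in\mathbb R\}$. $\mathrm{QRA}(n)$ is the algebra of all $\tilde{\mathbb C}$-linear combinations of elements of the subalgebra $\mathbb G_{2n}$ generated by $e_1,\dots,e_{2n}$. For $i=1,\dots,n$ put $$f_i=\tfrac12(e_i+\iota e_{i+n}),\qquad f_i^\dagger=\tfrac12(e_i-\iota e_{i+n}).$$ Now let $n=3$. For $(k,l)\in\{(1,2),(2,3)\}$ and $\gamma\in\mathbb R$ define $$J_{(k,l)}(\gamma)=\cos\tfrac{\gamma}{2}\,\big(f_kf_k^\dagger f_lf_l^\dagger+f_k^\dagger f_kf_lf_l^\dagger+f_kf_k^\dagger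 f_l^\dagger f_l+f_k^\dagger f_kf_l^\dagger f_l\big)+\iota\sin\tfrac{\gamma}{2}\,\big(-f_kf_l+f_kf_l^\dagger-f_k^\dagger f_l+f_k^\dagger f_l^\dagger\big),$$ $$\mathrm{Id}(k)=f_kf_k^\dagger+f_k^\dagger f_k,\qquad \mathrm{SWAP}_{12}=f_1f_1^\dagger f_2f_2^\dagger+f_1^\dagger f_2-f_1f_2^\dagger+f_1^\dagger f_1f_2^\dagger f_2 .$$ The three pairwise entanglement gates are $$J_{12}(\gamma_{12})=J_{(1,2)}(\gamma_{12})\,\mathrm{Id}(3),\quad J_{23}(\gamma_{23})=\mathrm{Id}(1)\,J_{(2,3)}(\gamma_{23}),\quad J_{13}(\gamma_{13})=\mathrm{SWAP}_{12}\,\mathrm{Id}(1)\,J_{(2,3)}(\gamma_{13})\,\mathrm{SWAP}_{12}.$$ The gate $\hat J_2(\gamma_{12},\gamma_{13},\gamma_{23})$ is by definition the product $J_{13}(\gamma_{13})\,J_{23}(\gamma_{23})\,J_{12}(\gamma_{12})$. *)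

theory Defs
  imports "HOL-Analysis.Analysis"
begin

section \<open>The geometric algebra of positive definite signature\<close>

text \<open>
  The type \<open>multivector\<close> is the real Clifford algebra on countably many orthonormal generators
  \<open>e j\<close>. An element is a function assigning to each finite set \<open>A = {a\<^sub>1 < \<dots> < a\<^sub>k}\<close> of indices
  the coefficient of the basis blade \<open>e a\<^sub>1 * \<dots> * e a\<^sub>k\<close>; only finitely many generators may occur.
  The algebra \<open>\<G>\<^sub>m\<close> on \<open>m\<close> generators is the subalgebra \<open>geometric_algebra m\<close> generated by
  \<open>e 1, \<dots>, e m\<close>; it has dimension \<open>2 ^ m\<close>, see \<open>dim_geometric_algebra\<close> below.
\<close>

typedef multivector =
  "{x :: nat set \<Rightarrow> real. \<exists>F. finite F \<and> (\<forall>A. x A \<noteq> 0 \<longrightarrow> A \<subseteq> F)}"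
  morphisms mv_coeff Abs_mv
  by (rule exI[of _ "\<lambda>_. 0"]) auto

setup_lifting type_definition_multivector

text \<open>
  Sorting the product of the blades on \<open>A\<close> and \<open>B\<close> costs one sign for every pair
  \<open>a \<in> A\<close>, \<open>b \<in> B\<close> with \<open>b < a\<close>; afterwards repeated generators cancel because they square
  to \<open>1\<close>, which leaves the blade on the symmetric difference of \<open>A\<close> and \<open>B\<close>.
\<close>

definition blade_sign :: "nat set \<Rightarrow> nat set \<Rightarrow> real" where
  "blade_sign A B = (\<Prod>a\<in>A. \<Prod>b\<in>B. if b < a then -1 else 1)"

lemma prod_sym_diff:
  fixes f :: "'a \<Rightarrow> real"
  assumes "finite A" "finite B" "\<And>x. f x * f x = 1"
  shows "prod f (sym_diff A B) = prod f A * prod f B"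
proof -
  have "prod f A = prod f (A - B) * prod f (A \<inter> B)"
    using assms(1) by (subst prod.union_disjoint[symmetric]) (auto intro: prod.cong)
  moreover have "prod f B = prod f (B - A) * prod f (A \<inter> B)"
    using assms(2) by (subst prod.union_disjoint[symmetric]) (auto intro: prod.cong)
  moreover have "prod f (A \<inter> B) * prod f (A \<inter> B) = 1"
    by (simp flip: prod.distrib add: assms(3))
  moreover have "prod f (sym_diff A B) = prod f (A - B) * prod f (B - A)"
    using assms by (intro prod.union_disjoint) auto
  ultimately show ?thesis
    by (simp add: algebra_simps)
qed

lemma blade_sign_sym_diff_left:
  assumes "finite A" "finite A'"
  shows "blade_sign (sym_diff A A') B = blade_sign A B * blade_sign A' B"
  unfolding blade_sign_def
  by (rule prod_sym_diff) (auto simp flip: prod.distrib simp: assms intro!: prod.neutral)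

lemma blade_sign_sym_diff_right:
  assumes "finite B" "finite B'"
  shows "blade_sign A (sym_diff B B') = blade_sign A B * blade_sign A B'"
  unfolding blade_sign_def
  by (subst prod_sym_diff) (auto simp: assms prod.distrib)

lemma blade_sign_empty [simp]: "blade_sign {} B = 1" "blade_sign A {} = 1"
  by (auto simp: blade_sign_def)

lift_definition blade :: "nat set \<Rightarrow> multivector" is
  "\<lambda>A B. if finite A \<and> B = A then 1 else 0"
proof -
  fix A :: "nat set"
  show "\<exists>F. finite F \<and> (\<forall>B. (if finite A \<and> B = A then 1 else 0 :: real) \<noteq> 0 \<longrightarrow> B \<subseteq> F)"
    by (rule exI[of _ "if finite A then A else {}"]) simp
qed

lemma mv_eqI: "(\<And>A. mv_coeff x A = mv_coeff y A) \<Longrightarrow> x = y"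
  by (metis ext mv_coeff_inject)

instantiation multivector :: real_vector
begin

lift_definition zero_multivector :: multivector is "\<lambda>_. 0"
  by auto

lift_definition plus_multivector :: "multivector \<Rightarrow> multivector \<Rightarrow> multivector" is
  "\<lambda>x y A. x A + y A"
proof -
  fix x y :: "nat set \<Rightarrow> real"
  assume x: "\<exists>F. finite F \<and> (\<forall>A. x A \<noteq> 0 \<longrightarrow> A \<subseteq> F)"
    and y: "\<exists>F. finite F \<and> (\<forall>A. y A \<noteq> 0 \<longrightarrow> A \<subseteq> F)"
  obtain F where F: "finite F" "\<forall>A. x A \<noteq> 0 \<longrightarrow> A \<subseteq> F"
    using x by (elim exE conjE)
  obtain G where G: "finite G" "\<forall>A. y A \<noteq> 0 \<longrightarrow> A \<subseteq> G"
    using y by (elim exE conjE)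
  note FG = F G
  have "A \<subseteq> F \<union> G" if "x A + y A \<noteq> 0" for A
  proof (cases "x A = 0")
    case True
    with that have "y A \<noteq> 0"
      by simp
    with FG show ?thesis
      by blast
  next
    case False
    with FG show ?thesis
      by blast
  qed
  with FG show "\<exists>F. finite F \<and> (\<forall>A. x A + y A \<noteq> 0 \<longrightarrow> A \<subseteq> F)"
    by (intro exI[of _ "F \<union> G"]) simp
qed

lift_definition uminus_multivector :: "multivector \<Rightarrow> multivector" is "\<lambda>x A. - x A"
  by simp

definition minus_multivector :: "multivector \<Rightarrow> multivector \<Rightarrow> multivector" where
  "minus_multivector x y = x + (- y)"

lift_definition scaleR_multivector :: "real \<Rightarrow> multivector \<Rightarrow> multivector" is "\<lambda>c x A. c * x A"
  by (simp, blast)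

instance
proof
  note reps = zero_multivector.rep_eq plus_multivector.rep_eq uminus_multivector.rep_eq
    scaleR_multivector.rep_eq
  fix x y z :: multivector and a b :: real
  show "x + y + z = x + (y + z)" by (intro mv_eqI) (simp add: reps add.assoc)
  show "x + y = y + x" by (intro mv_eqI) (simp add: reps add.commute)
  show "0 + x = x" by (intro mv_eqI) (simp add: reps)
  show "- x + x = 0" by (intro mv_eqI) (simp add: reps)
  show "x - y = x + - y" by (fact minus_multivector_def)
  show "a *\<^sub>R (x + y) = a *\<^sub>R x + a *\<^sub>R y" by (intro mv_eqI) (simp add: reps distrib_left)
  show "(a + b) *\<^sub>R x = a *\<^sub>R x + b *\<^sub>R x" by (intro mv_eqI) (simp add: reps distrib_right)
  show "a *\<^sub>R b *\<^sub>R x = (a * b) *\<^sub>R x" by (intro mv_eqI) (simp add: reps mult.assoc)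
  show "1 *\<^sub>R x = x" by (intro mv_eqI) (simp add: reps)
qed

end

definition blade_mult ::
  "(nat set \<Rightarrow> real) \<Rightarrow> (nat set \<Rightarrow> real) \<Rightarrow> nat set \<Rightarrow> real" where
  "blade_mult x y C =
     (\<Sum>A | x A \<noteq> 0. blade_sign A (sym_diff A C) * x A * y (sym_diff A C))"

lemma blade_mult_eq:
  assumes "finite F" "\<forall>A. x A \<noteq> 0 \<longrightarrow> A \<subseteq> F"
  shows "blade_mult x y C =
    (\<Sum>A\<in>Pow F. blade_sign A (sym_diff A C) * x A * y (sym_diff A C))"
  unfolding blade_mult_def using assms by (intro sum.mono_neutral_left) auto

lemma blade_mult_support:
  assumes "\<forall>A. x A \<noteq> 0 \<longrightarrow> A \<subseteq> F" "\<forall>A. y A \<noteq> 0 \<longrightarrow> A \<subseteq> F"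
    and "blade_mult x y C \<noteq> 0"
  shows "C \<subseteq> F"
proof -
  obtain A where "x A \<noteq> 0" "y (sym_diff A C) \<noteq> 0"
    using assms(3) unfolding blade_mult_def
    by (elim sum.not_neutral_contains_not_neutral) simp
  then have "A \<subseteq> F" "sym_diff A C \<subseteq> F"
    using assms(1,2) by blast+
  then show ?thesis
    by blast
qed

lemma blade_mult_assoc:
  assumes F: "finite F" and x: "\<forall>A. x A \<noteq> 0 \<longrightarrow> A \<subseteq> F" and y: "\<forall>A. y A \<noteq> 0 \<longrightarrow> A \<subseteq> F"
    and z: "\<forall>A. z A \<noteq> 0 \<longrightarrow> A \<subseteq> F"
  shows "blade_mult (blade_mult x y) z D = blade_mult x (blade_mult y z) D"
proof (cases "D \<subseteq> F")
  case False
  have xy: "\<forall>C. blade_mult x y C \<noteq> 0 \<longrightarrow> C \<subseteq> F"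
    using blade_mult_support[OF x y] by blast
  have yz: "\<forall>C. blade_mult y z C \<noteq> 0 \<longrightarrow> C \<subseteq> F"
    using blade_mult_support[OF y z] by blast
  have "blade_mult (blade_mult x y) z D = 0" "blade_mult x (blade_mult y z) D = 0"
    using blade_mult_support[OF xy z, of D] blade_mult_support[OF x yz, of D] False by blast+
  then show ?thesis
    by simp
next
  case D: True
  let ?d = "\<lambda>A B :: nat set. sym_diff A B"
  have xy: "\<forall>C. blade_mult x y C \<noteq> 0 \<longrightarrow> C \<subseteq> F"
    using blade_mult_support[OF x y] by blast
  have "blade_mult (blade_mult x y) z D =
    (\<Sum>C\<in>Pow F. \<Sum>A\<in>Pow F. blade_sign C (?d C D) * blade_sign A (?d A C) * x A * y (?d A C) * z (?d C D))"
    by (simp only: blade_mult_eq[OF F xy] blade_mult_eq[OF F x] sum_distrib_left sum_distrib_right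
        mult.assoc)
  also have "\<dots> = (\<Sum>A\<in>Pow F. \<Sum>C\<in>Pow F.
      blade_sign C (?d C D) * blade_sign A (?d A C) * x A * y (?d A C) * z (?d C D))"
    by (rule sum.swap)
  also have "\<dots> = (\<Sum>A\<in>Pow F. \<Sum>B\<in>Pow F.
      blade_sign A (?d A D) * blade_sign B (?d B (?d A D)) * x A * y B * z (?d B (?d A D)))"
  proof (rule sum.cong[OF refl])
    fix A assume "A \<in> Pow F"
    then have A: "A \<subseteq> F" "finite A"
      using F finite_subset by auto
    show "(\<Sum>C\<in>Pow F. blade_sign C (?d C D) * blade_sign A (?d A C) * x A * y (?d A C) * z (?d C D)) =
      (\<Sum>B\<in>Pow F. blade_sign A (?d A D) * blade_sign B (?d B (?d A D)) * x A * y B * z (?d B (?d A D)))"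
    proof (rule sum.reindex_bij_witness[where i = "?d A" and j = "?d A"])
      fix C assume "C \<in> Pow F"
      then have C: "C \<subseteq> F" "finite C"
        using F finite_subset by auto
      have fin: "finite D" "finite (?d C D)" "finite (?d A C)"
        using A C D F finite_subset by auto
      have 1: "?d (?d A C) (?d A D) = ?d C D"
        by blast
      have 2: "?d A D = ?d (?d A C) (?d C D)"
        by blast
      have "blade_sign A (?d A D) = blade_sign A (?d A C) * blade_sign A (?d C D)"
        unfolding 2 by (rule blade_sign_sym_diff_right) (use fin in auto)
      moreover have "blade_sign (?d A C) (?d C D) = blade_sign A (?d C D) * blade_sign C (?d C D)"
        by (rule blade_sign_sym_diff_left) (use A C in auto)
      moreover have "blade_sign A (?d C D) * blade_sign A (?d C D) = 1"
        unfolding blade_sign_def by (auto simp flip: prod.distrib intro!: prod.neutral)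
      ultimately have "blade_sign A (?d A D) * blade_sign (?d A C) (?d C D) =
          blade_sign C (?d C D) * blade_sign A (?d A C)"
        by (simp add: algebra_simps)
      then show "blade_sign A (?d A D) * blade_sign (?d A C) (?d (?d A C) (?d A D)) * x A *
          y (?d A C) * z (?d (?d A C) (?d A D)) =
          blade_sign C (?d C D) * blade_sign A (?d A C) * x A * y (?d A C) * z (?d C D)"
        unfolding 1 by simp
    qed (use A in auto)
  qed
  also have "\<dots> = blade_mult x (blade_mult y z) D"
    by (simp only: blade_mult_eq[OF F x] blade_mult_eq[OF F y] sum_distrib_left sum_distrib_right
        mult.assoc mult.left_commute[of _ "x _"])
  finally show ?thesis .
qed

lemma obtain_common_support:
  obtains F where "finite F" "\<forall>A. mv_coeff x A \<noteq> 0 \<longrightarrow> A \<subseteq> F" "\<forall>A. mv_coeff y A \<noteq> 0 \<longrightarrow> A \<subseteq> F"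
    "\<forall>A. mv_coeff z A \<noteq> 0 \<longrightarrow> A \<subseteq> F"
proof -
  obtain F where F: "finite F" "\<forall>A. mv_coeff x A \<noteq> 0 \<longrightarrow> A \<subseteq> F"
    using mv_coeff[of x] unfolding mem_Collect_eq by (elim exE conjE)
  obtain G where G: "finite G" "\<forall>A. mv_coeff y A \<noteq> 0 \<longrightarrow> A \<subseteq> G"
    using mv_coeff[of y] unfolding mem_Collect_eq by (elim exE conjE)
  obtain H where H: "finite H" "\<forall>A. mv_coeff z A \<noteq> 0 \<longrightarrow> A \<subseteq> H"
    using mv_coeff[of z] unfolding mem_Collect_eq by (elim exE conjE)
  show thesis
    using F G H by (intro that[of "F \<union> G \<union> H"]) blast+
qed

instantiation multivector :: real_algebra_1
begin

definition one_multivector :: multivector where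
  "one_multivector = blade {}"

lift_definition times_multivector :: "multivector \<Rightarrow> multivector \<Rightarrow> multivector" is blade_mult
proof -
  fix x y :: "nat set \<Rightarrow> real"
  assume x: "\<exists>F. finite F \<and> (\<forall>A. x A \<noteq> 0 \<longrightarrow> A \<subseteq> F)"
    and y: "\<exists>F. finite F \<and> (\<forall>A. y A \<noteq> 0 \<longrightarrow> A \<subseteq> F)"
  obtain F where F: "finite F" "\<forall>A. x A \<noteq> 0 \<longrightarrow> A \<subseteq> F"
    using x by (elim exE conjE)
  obtain G where G: "finite G" "\<forall>A. y A \<noteq> 0 \<longrightarrow> A \<subseteq> G"
    using y by (elim exE conjE)
  have x': "\<forall>A. x A \<noteq> 0 \<longrightarrow> A \<subseteq> F \<union> G" and y': "\<forall>A. y A \<noteq> 0 \<longrightarrow> A \<subseteq> F \<union> G"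
    using F G by blast+
  show "\<exists>F. finite F \<and> (\<forall>A. blade_mult x y A \<noteq> 0 \<longrightarrow> A \<subseteq> F)"
    using F(1) G(1) blade_mult_support[OF x' y'] by (intro exI[of _ "F \<union> G"]) simp
qed

instance
proof
  fix x y z :: multivector and c :: real
  obtain F where F: "finite F" and x: "\<forall>A. mv_coeff x A \<noteq> 0 \<longrightarrow> A \<subseteq> F"
    and y: "\<forall>A. mv_coeff y A \<noteq> 0 \<longrightarrow> A \<subseteq> F" and z: "\<forall>A. mv_coeff z A \<noteq> 0 \<longrightarrow> A \<subseteq> F"
    by (rule obtain_common_support[of x y z])
  have xy: "\<forall>A. mv_coeff (x + y) A \<noteq> 0 \<longrightarrow> A \<subseteq> F"
    using x y by (metis add_0 plus_multivector.rep_eq)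
  have cx: "\<forall>A. mv_coeff (c *\<^sub>R x) A \<noteq> 0 \<longrightarrow> A \<subseteq> F"
    using x by (metis mult_zero_right scaleR_multivector.rep_eq)
  show "x * y * z = x * (y * z)"
    by (rule mv_eqI) (simp add: times_multivector.rep_eq blade_mult_assoc[OF F x y z])
  show "(x + y) * z = x * z + y * z"
    by (rule mv_eqI)
      (simp add: times_multivector.rep_eq plus_multivector.rep_eq blade_mult_eq[OF F xy, unfolded plus_multivector.rep_eq]
        blade_mult_eq[OF F x] blade_mult_eq[OF F y] algebra_simps sum.distrib)
  show "x * (y + z) = x * y + x * z"
    by (rule mv_eqI)
      (simp add: times_multivector.rep_eq plus_multivector.rep_eq blade_mult_eq[OF F x]
        algebra_simps sum.distrib)
  show "c *\<^sub>R x * y = c *\<^sub>R (x * y)"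
    by (rule mv_eqI)
      (simp add: times_multivector.rep_eq scaleR_multivector.rep_eq
        blade_mult_eq[OF F cx, unfolded scaleR_multivector.rep_eq]
        blade_mult_eq[OF F x] algebra_simps sum_distrib_left)
  show "x * c *\<^sub>R y = c *\<^sub>R (x * y)"
    by (rule mv_eqI)
      (simp add: times_multivector.rep_eq scaleR_multivector.rep_eq blade_mult_eq[OF F x]
        algebra_simps sum_distrib_left)
  show "1 * x = x"
  proof (rule mv_eqI)
    fix C
    have "{A. mv_coeff (1::multivector) A \<noteq> 0} = {{}}"
      by (auto simp: one_multivector_def blade.rep_eq)
    then show "mv_coeff (1 * x) C = mv_coeff x C"
      by (simp add: times_multivector.rep_eq blade_mult_def) (simp add: one_multivector_def blade.rep_eq)
  qed
  show "x * 1 = x"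
  proof (rule mv_eqI)
    fix C :: "nat set"
    have eq: "sym_diff A C = {} \<longleftrightarrow> A = C" for A
      by blast
    have "mv_coeff (x * 1) C =
        (\<Sum>A | mv_coeff x A \<noteq> 0. if A = C then mv_coeff x C else 0)"
      unfolding times_multivector.rep_eq blade_mult_def
    proof (rule sum.cong[OF refl])
      fix A
      show "blade_sign A (sym_diff A C) * mv_coeff x A * mv_coeff 1 (sym_diff A C) =
          (if A = C then mv_coeff x C else 0)"
        using eq[of A] by (auto simp: one_multivector_def blade.rep_eq)
    qed
    also have "\<dots> = mv_coeff x C"
    proof (cases "mv_coeff x C = 0")
      case False
      have "finite {A. mv_coeff x A \<noteq> 0}"
        by (rule finite_subset[of _ "Pow F"]) (use x F in auto)
      with False show ?thesis
        by simp
    qed (auto intro: sum.neutral)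
    finally show "mv_coeff (x * 1) C = mv_coeff x C" .
  qed
  show "(0::multivector) \<noteq> 1"
  proof
    assume "(0::multivector) = 1"
    then have "mv_coeff 0 {} = mv_coeff 1 {}"
      by simp
    then show False
      by (simp add: zero_multivector.rep_eq one_multivector_def blade.rep_eq)
  qed
qed

end

lemma blade_times_blade:
  assumes "finite A" "finite B"
  shows "blade A * blade B = blade_sign A B *\<^sub>R blade (sym_diff A B)"
proof (rule mv_eqI)
  fix C
  have "{D. mv_coeff (blade A) D \<noteq> 0} = {A}"
    using assms by (auto simp: blade.rep_eq)
  moreover have "sym_diff A C = B \<longleftrightarrow> C = sym_diff A B"
    by blast
  ultimately show "mv_coeff (blade A * blade B) C = mv_coeff (blade_sign A B *\<^sub>R blade (sym_diff A B)) C"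
    using assms
    by (auto simp: times_multivector.rep_eq blade_mult_def scaleR_multivector.rep_eq blade.rep_eq)
qed

definition e :: "nat \<Rightarrow> multivector" where
  "e j = blade {j}"

lemma e_square: "e j * e j = 1"
  by (simp add: e_def blade_times_blade blade_sign_def one_multivector_def)

lemma e_anticommute:
  assumes "i \<noteq> j"
  shows "e i * e j = - (e j * e i)"
proof -
  have "sym_diff {i} {j} = {i, j}" "sym_diff {j} {i} = {i, j}"
    using assms by auto
  then show ?thesis
    using assms by (cases "i < j") (simp_all add: e_def blade_times_blade blade_sign_def)
qed

inductive_set generated_subalgebra :: "'a::real_algebra_1 set \<Rightarrow> 'a set" for S where
  gen: "x \<in> S \<Longrightarrow> x \<in> generated_subalgebra S"
| one: "1 \<in> generated_subalgebra S"
| add: "x \<in> generated_subalgebra S \<Longrightarrow> y \<in> generated_subalgebra S \<Longrightarrow> x + y \<in> generated_subalgebra S"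
| mult: "x \<in> generated_subalgebra S \<Longrightarrow> y \<in> generated_subalgebra S \<Longrightarrow> x * y \<in> generated_subalgebra S"
| scale: "x \<in> generated_subalgebra S \<Longrightarrow> c *\<^sub>R x \<in> generated_subalgebra S"

definition geometric_algebra :: "nat \<Rightarrow> multivector set" where
  "geometric_algebra m = generated_subalgebra (e ` {1..m})"

lemma blade_in_geometric_algebra:
  assumes "A \<subseteq> {1..m}"
  shows "blade A \<in> geometric_algebra m"
proof -
  have "finite A"
    using assms finite_subset by blast
  then show ?thesis
    using assms
  proof (induction A rule: finite_linorder_max_induct)
    case empty
    then show ?case
      by (metis geometric_algebra_def generated_subalgebra.one one_multivector_def)
  next
    case (insert b A)
    have "blade A * e b = blade_sign A {b} *\<^sub>R blade (sym_diff A {b})"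
      unfolding e_def using insert by (intro blade_times_blade) auto
    also have "blade_sign A {b} = 1"
      unfolding blade_sign_def using insert.hyps by (intro prod.neutral) fastforce
    also have "sym_diff A {b} = insert b A"
      using insert.hyps by auto
    finally have "blade (insert b A) = blade A * e b"
      by simp
    then show ?case
      using insert unfolding geometric_algebra_def
      by (auto intro!: generated_subalgebra.mult intro: generated_subalgebra.gen)
  qed
qed

lemma geometric_algebra_eq_span: "geometric_algebra m = span (blade ` Pow {1..m})"
proof (intro equalityI subsetI)
  fix x assume "x \<in> geometric_algebra m"
  then show "x \<in> span (blade ` Pow {1..m})"
    unfolding geometric_algebra_def
  proof (induction rule: generated_subalgebra.induct)
    case (gen x)
    then show ?case
      by (auto simp: e_def intro!: span_base)
  next
    case one
    then show ?case
      by (auto simp: one_multivector_def intro!: span_base)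
  next
    case (mult x y)
    have left: "blade A * w \<in> span (blade ` Pow {1..m})"
      if A: "A \<subseteq> {1..m}" and w: "w \<in> span (blade ` Pow {1..m})" for A w
      using w
    proof (induction rule: span_induct_alt)
      case base
      then show ?case
        by (simp add: span_zero)
    next
      case (step c b z)
      then obtain B where B: "b = blade B" "B \<subseteq> {1..m}"
        by auto
      then have "blade A * b = blade_sign A B *\<^sub>R blade (sym_diff A B)"
        using finite_subset[OF A] finite_subset[OF B(2)] by (simp add: blade_times_blade)
      moreover have "sym_diff A B \<in> Pow {1..m}"
        using A B by auto
      ultimately show ?case
        using step by (auto simp: ring_distribs intro!: span_add span_scale intro: span_base)
    qed
    have "u * y \<in> span (blade ` Pow {1..m})" if "u \<in> span (blade ` Pow {1..m})" for u
      using that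
    proof (induction rule: span_induct_alt)
      case base
      then show ?case
        by (simp add: span_zero)
    next
      case (step c b z)
      then show ?case
        using left[OF _ mult.IH(2)] by (auto simp: ring_distribs intro!: span_add span_scale)
    qed
    then show ?case
      using mult.IH(1) .
  qed (auto intro: span_add span_scale)
next
  fix x assume "x \<in> span (blade ` Pow {1..m})"
  then show "x \<in> geometric_algebra m"
  proof (induction rule: span_induct_alt)
    case base
    have "0 *\<^sub>R 1 \<in> geometric_algebra m"
      unfolding geometric_algebra_def by (intro generated_subalgebra.scale generated_subalgebra.one)
    then show ?case
      by simp
  next
    case (step c b z)
    then show ?case
      using blade_in_geometric_algebra unfolding geometric_algebra_def
      by (auto intro!: generated_subalgebra.add generated_subalgebra.scale)
  qed
qed

lemma mv_coeff_sum: "mv_coeff (sum f I) A = (\<Sum>i\<in>I. mv_coeff (f i) A)"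
  by (induction I rule: infinite_finite_induct)
    (auto simp: zero_multivector.rep_eq plus_multivector.rep_eq)

lemma inj_on_blade: "inj_on blade (Collect finite)"
proof (rule inj_onI)
  fix A B :: "nat set"
  assume "A \<in> Collect finite" "B \<in> Collect finite" "blade A = blade B"
  then have "mv_coeff (blade A) A = mv_coeff (blade B) A" "finite A" "finite B"
    by auto
  then show "A = B"
    by (auto simp: blade.rep_eq split: if_splits)
qed

lemma dim_geometric_algebra: "dim (geometric_algebra m) = 2 ^ m"
proof -
  let ?P = "Pow {1..m}"
  have inj: "inj_on blade ?P"
    by (rule inj_on_subset[OF inj_on_blade]) (auto intro: finite_subset)
  have "independent (blade ` ?P)"
  proof (rule independent_if_scalars_zero)
    fix g x
    assume sum: "(\<Sum>x\<in>blade ` ?P. g x *\<^sub>R x) = 0" and "x \<in> blade ` ?P"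
    then obtain A where A: "x = blade A" "A \<in> ?P"
      by auto
    have "0 = mv_coeff (\<Sum>x\<in>blade ` ?P. g x *\<^sub>R x) A"
      using sum by (simp add: zero_multivector.rep_eq)
    also have "\<dots> = (\<Sum>B\<in>?P. mv_coeff (g (blade B) *\<^sub>R blade B) A)"
      unfolding mv_coeff_sum sum.reindex[OF inj] by (simp only: o_def)
    also have "\<dots> = (\<Sum>B\<in>?P. if B = A then g (blade A) else 0)"
      by (rule sum.cong) (auto simp: scaleR_multivector.rep_eq blade.rep_eq intro: finite_subset)
    also have "\<dots> = g x"
      using A by simp
    finally show "g x = 0"
      by simp
  qed simp
  then have "dim (blade ` ?P) = card (blade ` ?P)"
    by (rule dim_eq_card_independent)
  also have "\<dots> = 2 ^ m"
    unfolding card_image[OF inj] by (simp add: card_Pow)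
  finally show ?thesis
    unfolding geometric_algebra_eq_span dim_span .
qed

section \<open>The quantum register algebra\<close>

text \<open>
  For \<open>n\<close> qubits the two extra generators \<open>r\<^sub>1, r\<^sub>2\<close> of \<open>\<G>\<^bsub>2n+2\<^esub>\<close> are \<open>e (2 * n + 1)\<close> and
  \<open>e (2 * n + 2)\<close>, so that \<open>r\<^sub>1\<close>, \<open>r\<^sub>2\<close> and everything built from them depend on \<open>n\<close>.
\<close>

definition r1 :: "nat \<Rightarrow> multivector" where
  "r1 n = e (2 * n + 1)"

definition r2 :: "nat \<Rightarrow> multivector" where
  "r2 n = e (2 * n + 2)"

definition iota :: "nat \<Rightarrow> multivector" where
  "iota n = r1 n * r2 n"

definition complex_scalars :: "nat \<Rightarrow> multivector set" where
  "complex_scalars n = {a *\<^sub>R 1 + b *\<^sub>R iota n | a b. True}"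

definition QRA :: "nat \<Rightarrow> multivector set" where
  "QRA n = {(\<Sum>k<m. c k * g k) | (m::nat) c g.
     \<forall>k<m. c k \<in> complex_scalars n \<and> g k \<in> geometric_algebra (2 * n)}"

lemma iota_square: "iota n * iota n = - 1"
proof -
  have "iota n * iota n = r1 n * (r2 n * r1 n) * r2 n"
    by (simp add: iota_def mult.assoc)
  also have "r2 n * r1 n = - (r1 n * r2 n)"
    unfolding r1_def r2_def by (rule e_anticommute) simp
  also have "r1 n * - (r1 n * r2 n) * r2 n = - ((r1 n * r1 n) * (r2 n * r2 n))"
    by (simp add: mult.assoc)
  finally show ?thesis
    by (simp add: r1_def r2_def e_square)
qed

lemma iota_commute:
  assumes "j \<le> 2 * n"
  shows "iota n * e j = e j * iota n"
proof -
  have "r2 n * e j = - (e j * r2 n)" "r1 n * e j = - (e j * r1 n)"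
    unfolding r1_def r2_def using assms by (auto intro!: e_anticommute)
  then have "r1 n * (r2 n * e j) = e j * r1 n * r2 n"
    by (simp flip: mult.assoc)
  then show ?thesis
    by (simp add: iota_def mult.assoc)
qed

definition f :: "nat \<Rightarrow> nat \<Rightarrow> multivector" where
  "f n i = (1/2) *\<^sub>R (e i + iota n * e (i + n))"

definition f_dagger :: "nat \<Rightarrow> nat \<Rightarrow> multivector" where
  "f_dagger n i = (1/2) *\<^sub>R (e i - iota n * e (i + n))"

section \<open>Entanglement gates on three qubits\<close>

abbreviation f3 :: "nat \<Rightarrow> multivector" (\<open>\<f>\<close>) where
  "\<f> \<equiv> f 3"

abbreviation f3_dagger :: "nat \<Rightarrow> multivector" (\<open>\<f>\<^sup>\<dagger>\<close>) where
  "\<f>\<^sup>\<dagger> \<equiv> f_dagger 3"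

definition J_pair :: "nat \<Rightarrow> nat \<Rightarrow> real \<Rightarrow> multivector" where
  "J_pair k l \<gamma> =
     cos (\<gamma> / 2) *\<^sub>R
       (\<f> k * \<f>\<^sup>\<dagger> k * \<f> l * \<f>\<^sup>\<dagger> l + \<f>\<^sup>\<dagger> k * \<f> k * \<f> l * \<f>\<^sup>\<dagger> l
        + \<f> k * \<f>\<^sup>\<dagger> k * \<f>\<^sup>\<dagger> l * \<f> l + \<f>\<^sup>\<dagger> k * \<f> k * \<f>\<^sup>\<dagger> l * \<f> l)
     + sin (\<gamma> / 2) *\<^sub>R (iota 3 *
       (- (\<f> k * \<f> l) + \<f> k * \<f>\<^sup>\<dagger> l - \<f>\<^sup>\<dagger> k * \<f> l + \<f>\<^sup>\<dagger> k * \<f>\<^sup>\<dagger> l))"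

definition Id_gate :: "nat \<Rightarrow> multivector" where
  "Id_gate k = \<f> k * \<f>\<^sup>\<dagger> k + \<f>\<^sup>\<dagger> k * \<f> k"

definition SWAP12 :: multivector where
  "SWAP12 = \<f> 1 * \<f>\<^sup>\<dagger> 1 * \<f> 2 * \<f>\<^sup>\<dagger> 2 + \<f>\<^sup>\<dagger> 1 * \<f> 2 - \<f> 1 * \<f>\<^sup>\<dagger> 2
     + \<f>\<^sup>\<dagger> 1 * \<f> 1 * \<f>\<^sup>\<dagger> 2 * \<f> 2"

definition J12 :: "real \<Rightarrow> multivector" where
  "J12 \<gamma> = J_pair 1 2 \<gamma> * Id_gate 3"

definition J23 :: "real \<Rightarrow> multivector" where
  "J23 \<gamma> = Id_gate 1 * J_pair 2 3 \<gamma>"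

definition J13 :: "real \<Rightarrow> multivector" where
  "J13 \<gamma> = SWAP12 * Id_gate 1 * J_pair 2 3 \<gamma> * SWAP12"

definition J_hat2 :: "real \<Rightarrow> real \<Rightarrow> real \<Rightarrow> multivector" where
  "J_hat2 \<gamma>\<^sub>1\<^sub>2 \<gamma>\<^sub>1\<^sub>3 \<gamma>\<^sub>2\<^sub>3 = J13 \<gamma>\<^sub>1\<^sub>3 * J23 \<gamma>\<^sub>2\<^sub>3 * J12 \<gamma>\<^sub>1\<^sub>2"

end

theory Submission
  imports Defs
begin

text \<open>
  In terms of the generators all three gates are elementary. Since \<open>f\<^sub>k + f\<^sub>k\<^sup>\<dagger> = e\<^sub>k\<close> and
  \<open>f\<^sub>l\<^sup>\<dagger> - f\<^sub>l = - \<iota> e\<^bsub>l+3\<^esub>\<close>, one gets \<open>J\<^sub>1\<^sub>2 = cos + sin E\<close> and \<open>J\<^sub>2\<^sub>3 = cos + sin Q\<close> with the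
  disjoint, hence commuting, bivectors \<open>E = e\<^sub>1 e\<^sub>5\<close> and \<open>Q = e\<^sub>2 e\<^sub>6\<close>. The swap gate is
  \<open>(1 + p + q - p q) / 2\<close> for the commuting involutions \<open>p = \<iota> e\<^sub>1 e\<^sub>5\<close> and \<open>q = - \<iota> e\<^sub>4 e\<^sub>2\<close>; as \<open>p\<close>
  commutes with \<open>Q\<close> and \<open>q\<close> anticommutes with it, conjugation by the swap maps \<open>Q\<close> to \<open>p Q\<close>.
  Thus \<open>J\<^sub>1\<^sub>3 = cos + sin \<iota> E Q\<close>, which commutes with the other two gates.
\<close>

section \<open>Signs of products of generators and bivectors\<close>

lemma anticommute_product_commute:
  fixes a b c :: "'a::ring"
  assumes "a * b = - (b * a)" "a * c = - (c * a)"
  shows "a * (b * c) = b * c * a"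
proof -
  have "a * (b * c) = - (b * (a * c))"
    using assms(1) by (simp flip: mult.assoc)
  then show ?thesis
    by (simp add: assms(2) mult.assoc)
qed

lemma commute_product:
  fixes a b c :: "'a::semigroup_mult"
  assumes "a * b = b * a" "a * c = c * a"
  shows "a * (b * c) = b * c * a"
  by (metis assms mult.assoc)

text \<open>Each generator of one pair passes both generators of the other, so the signs cancel in
  pairs.\<close>

lemma e_pair_commute:
  assumes "i \<noteq> k" "i \<noteq> l" "j \<noteq> k" "j \<noteq> l"
  shows "(e i * e j) * (e k * e l) = (e k * e l) * (e i * e j)"
proof -
  have "(e k * e l) * e i = e i * (e k * e l)" "(e k * e l) * e j = e j * (e k * e l)"
    using assms by (intro anticommute_product_commute[symmetric] e_anticommute; simp)+
  then show ?thesis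
    by (rule commute_product[symmetric])
qed

lemma iota_pair_commute:
  assumes "i \<le> 2 * n" "j \<le> 2 * n"
  shows "iota n * (e i * e j) = e i * e j * iota n"
  using assms by (intro commute_product iota_commute)

lemma e_pair_square:
  assumes "i \<noteq> j"
  shows "(e i * e j) * (e i * e j) = - 1"
proof -
  have "(e i * e j) * (e i * e j) = e i * (e j * e i) * e j"
    by (simp add: mult.assoc)
  also have "\<dots> = - ((e i * e i) * (e j * e j))"
    using e_anticommute[OF assms] by (simp add: mult.assoc e_anticommute[OF assms[symmetric]])
  finally show ?thesis
    by (simp add: e_square)
qed

text \<open>The second \<open>iota n\<close> moves left past the bivector and meets the first one.
  The trailing factor \<open>x\<close> lets the rule act inside longer products.\<close>

lemma iota_pair_times_iota:
  assumes "i \<le> 2 * n" "j \<le> 2 * n"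
  shows "iota n * (e i * e j) * (iota n * x) = - (e i * e j * x)"
proof -
  have "iota n * (e i * e j) * (iota n * x) = iota n * (e i * e j * iota n) * x"
    by (simp only: mult.assoc)
  also have "\<dots> = (iota n * iota n) * (e i * e j * x)"
    unfolding iota_pair_commute[OF assms, symmetric] by (simp only: mult.assoc)
  finally show ?thesis
    by (simp add: iota_square)
qed

lemma iota_pair_square:
  assumes "i \<noteq> j" "i \<le> 2 * n" "j \<le> 2 * n"
  shows "(iota n * (e i * e j)) * (iota n * (e i * e j)) = 1"
  using assms by (simp add: iota_pair_times_iota e_pair_square)

section \<open>The gates in terms of generators\<close>

lemma half_times_half: "((1/2) *\<^sub>R x) * ((1/2) *\<^sub>R y) = (1/4) *\<^sub>R (x * y)"
  for x y :: "'a::real_algebra"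
  by simp

lemma f_plus_f_dagger: "f n i + f_dagger n i = e i"
  by (simp add: f_def f_dagger_def flip: scaleR_add_right scaleR_2)

lemma f_dagger_minus_f: "f_dagger n i - f n i = - (iota n * e (i + n))"
proof -
  have "f_dagger n i - f n i = (1/2) *\<^sub>R (2 *\<^sub>R (- (iota n * e (i + n))))"
    unfolding f_def f_dagger_def scaleR_2 by (simp flip: scaleR_diff_right)
  then show ?thesis
    by simp
qed

text \<open>With \<open>z = iota n * (e i * e (i + n))\<close>, an involution, the two products are
  the complementary idempotents \<open>(1 - z)/2\<close> and \<open>(1 + z)/2\<close>. Their sum is
  1, which makes \<open>Id_gate\<close> trivial.\<close>

lemma
  assumes "0 < n" "i \<le> n"
  shows f_times_f_dagger: "f n i * f_dagger n i = (1/2) *\<^sub>R (1 - iota n * (e i * e (i + n)))"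
    and f_dagger_times_f: "f_dagger n i * f n i = (1/2) *\<^sub>R (1 + iota n * (e i * e (i + n)))"
proof -
  let ?z = "iota n * (e i * e (i + n))"
  have comm: "e i * iota n = iota n * e i" "e (i + n) * iota n = iota n * e (i + n)"
    using assms by (simp_all add: iota_commute)
  have ab: "e i * (iota n * e (i + n)) = ?z"
    using comm by (metis mult.assoc)
  \<comment> \<open>Here \<open>0 < n\<close> keeps \<open>i + n\<close> apart from
    \<open>i\<close>, so the two generators anticommute.\<close>
  have ba: "iota n * e (i + n) * e i = - ?z"
    using assms by (simp add: mult.assoc e_anticommute[of "i + n" i])
  have "iota n * e (i + n) * (iota n * e (i + n)) = (iota n * iota n) * (e (i + n) * e (i + n))"
    using comm by (metis mult.assoc)
  then have bb: "iota n * e (i + n) * (iota n * e (i + n)) = - 1"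
    by (simp add: iota_square e_square)
  have two: "(1/4) *\<^sub>R (x + x) = (1/2) *\<^sub>R x" for x :: multivector
    by (simp flip: scaleR_2)
  have "(e i + iota n * e (i + n)) * (e i - iota n * e (i + n)) = (1 - ?z) + (1 - ?z)"
    by (simp add: ring_distribs ab ba bb e_square)
  then show "f n i * f_dagger n i = (1/2) *\<^sub>R (1 - ?z)"
    by (simp only: f_def f_dagger_def half_times_half two)
  have "(e i - iota n * e (i + n)) * (e i + iota n * e (i + n)) = (1 + ?z) + (1 + ?z)"
    by (simp add: ring_distribs ab ba bb e_square)
  then show "f_dagger n i * f n i = (1/2) *\<^sub>R (1 + ?z)"
    by (simp only: f_def f_dagger_def half_times_half two)
qed

lemma Id_gate_eq_1:
  assumes "k \<le> 3"
  shows "Id_gate k = 1"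
  using assms by (simp add: Id_gate_def f_times_f_dagger f_dagger_times_f flip: scaleR_add_right scaleR_2)

text \<open>Both brackets factor: the cosine one is \<open>Id_gate k * Id_gate l\<close>, the sine
  one is a sum for qubit \<open>k\<close> times a difference for qubit \<open>l\<close>. The latter
  carries a factor \<open>- iota 3\<close>, which the outer \<open>iota 3\<close> turns into
  1.\<close>

lemma J_pair_eq:
  assumes "k \<le> 3" "l \<le> 3"
  shows "J_pair k l \<gamma> = cos (\<gamma> / 2) *\<^sub>R 1 + sin (\<gamma> / 2) *\<^sub>R (e k * e (l + 3))"
proof -
  have "\<f> k * \<f>\<^sup>\<dagger> k * \<f> l * \<f>\<^sup>\<dagger> l + \<f>\<^sup>\<dagger> k * \<f> k * \<f> l * \<f>\<^sup>\<dagger> l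
      + \<f> k * \<f>\<^sup>\<dagger> k * \<f>\<^sup>\<dagger> l * \<f> l + \<f>\<^sup>\<dagger> k * \<f> k * \<f>\<^sup>\<dagger> l * \<f> l = Id_gate k * Id_gate l"
    by (simp add: Id_gate_def ring_distribs mult.assoc)
  also have "\<dots> = 1"
    using assms by (simp add: Id_gate_eq_1)
  finally have diagonal: "\<f> k * \<f>\<^sup>\<dagger> k * \<f> l * \<f>\<^sup>\<dagger> l + \<f>\<^sup>\<dagger> k * \<f> k * \<f> l * \<f>\<^sup>\<dagger> l
      + \<f> k * \<f>\<^sup>\<dagger> k * \<f>\<^sup>\<dagger> l * \<f> l + \<f>\<^sup>\<dagger> k * \<f> k * \<f>\<^sup>\<dagger> l * \<f> l = 1" .
  have "- (\<f> k * \<f> l) + \<f> k * \<f>\<^sup>\<dagger> l - \<f>\<^sup>\<dagger> k * \<f> l + \<f>\<^sup>\<dagger> k * \<f>\<^sup>\<dagger> l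
      = (\<f> k + \<f>\<^sup>\<dagger> k) * (\<f>\<^sup>\<dagger> l - \<f> l)"
    by (simp add: ring_distribs)
  also have "\<dots> = - (iota 3 * (e k * e (l + 3)))"
    using iota_commute[of k 3] assms
    by (simp add: f_plus_f_dagger f_dagger_minus_f flip: mult.assoc)
  finally have "iota 3 * (- (\<f> k * \<f> l) + \<f> k * \<f>\<^sup>\<dagger> l - \<f>\<^sup>\<dagger> k * \<f> l + \<f>\<^sup>\<dagger> k * \<f>\<^sup>\<dagger> l)
      = e k * e (l + 3)"
    by (simp add: iota_square flip: mult.assoc)
  with diagonal show ?thesis
    by (simp only: J_pair_def)
qed

lemma SWAP12_eq:
  fixes p q :: multivector
  defines "p \<equiv> iota 3 * (e 1 * e 5)" and "q \<equiv> - (iota 3 * (e 4 * e 2))"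
  shows "SWAP12 = (1/2) *\<^sub>R (1 + p + q - p * q)"
proof -
  \<comment> \<open>These are the involutions in the idempotents of qubits 1 and 2. The diagonal
    part of the swap is \<open>(1 + z1 * z2)/2\<close>, the rest is
    \<open>(p + q)/2\<close>.\<close>
  define z1 z2 where "z1 = iota 3 * (e 1 * e 4)" and "z2 = iota 3 * (e 2 * e 5)"
  have "\<f> 1 * \<f>\<^sup>\<dagger> 1 * \<f> 2 * \<f>\<^sup>\<dagger> 2 + \<f>\<^sup>\<dagger> 1 * \<f> 1 * \<f>\<^sup>\<dagger> 2 * \<f> 2
      = (\<f> 1 * \<f>\<^sup>\<dagger> 1) * (\<f> 2 * \<f>\<^sup>\<dagger> 2) + (\<f>\<^sup>\<dagger> 1 * \<f> 1) * (\<f>\<^sup>\<dagger> 2 * \<f> 2)"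
    by (simp only: mult.assoc)
  also have "\<dots> = (1/4) *\<^sub>R ((1 - z1) * (1 - z2) + (1 + z1) * (1 + z2))"
    using f_times_f_dagger[of 3 1] f_dagger_times_f[of 3 1]
      f_times_f_dagger[of 3 2] f_dagger_times_f[of 3 2]
    by (simp add: z1_def z2_def half_times_half
        flip: scaleR_add_right scaleR_diff_right)
  also have "\<dots> = (1/4) *\<^sub>R (2 *\<^sub>R (1 + z1 * z2))"
    by (simp add: ring_distribs scaleR_2)
  finally have diagonal: "\<f> 1 * \<f>\<^sup>\<dagger> 1 * \<f> 2 * \<f>\<^sup>\<dagger> 2 + \<f>\<^sup>\<dagger> 1 * \<f> 1 * \<f>\<^sup>\<dagger> 2 * \<f> 2
      = (1/2) *\<^sub>R (1 + z1 * z2)"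
    by simp
  have comm: "e 1 * iota 3 = iota 3 * e 1" "e 2 * iota 3 = iota 3 * e 2"
      "e 4 * iota 3 = iota 3 * e 4" "e 5 * iota 3 = iota 3 * e 5"
    by (simp_all only: iota_commute)
  \<comment> \<open>Moving \<open>e 5\<close> past two generators regroups the pairs of
    \<open>z1\<close> and \<open>z2\<close> into those of \<open>p\<close> and
    \<open>q\<close>.\<close>
  have "(e 1 * e 4) * (e 2 * e 5) = e 1 * (e 5 * (e 4 * e 2))"
    using anticommute_product_commute[of "e 5" "e 4" "e 2"] e_anticommute[of 5 4] e_anticommute[of 5 2]
    by (simp add: mult.assoc)
  then have "z1 * z2 = - (p * q)"
    using iota_pair_times_iota[of 1 3 4] iota_pair_times_iota[of 1 3 5]
    by (simp add: z1_def z2_def p_def q_def mult.assoc)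
  moreover have "\<f>\<^sup>\<dagger> 1 * \<f> 2 - \<f> 1 * \<f>\<^sup>\<dagger> 2 = (1/2) *\<^sub>R (p + q)"
  proof -
    have "\<f>\<^sup>\<dagger> 1 * \<f> 2 - \<f> 1 * \<f>\<^sup>\<dagger> 2
      = (1/4) *\<^sub>R (2 *\<^sub>R (e 1 * (iota 3 * e 5) - iota 3 * e 4 * e 2))"
      unfolding f_def f_dagger_def half_times_half
      by (simp add: ring_distribs scaleR_2 flip: scaleR_diff_right)
    also have "e 1 * (iota 3 * e 5) = p"
      using comm unfolding p_def by (metis mult.assoc)
    finally show ?thesis
      by (simp add: q_def mult.assoc)
  qed
  ultimately show ?thesis
    using diagonal by (simp add: SWAP12_def algebra_simps)
qed

text \<open>Pulling \<open>Q\<close> to the left through \<open>1 + p + q - p * q\<close> flips the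
  sign of \<open>q\<close> and gives \<open>1 + p - q + p * q\<close>, which is \<open>p\<close>
  times the original factor. Hence \<open>U * Q = p * Q * U\<close>, and \<open>U * U = 1\<close>
  removes the last \<open>U\<close>.\<close>

lemma conjugation_by_swap:
  fixes p q Q :: "'a::real_algebra_1"
  assumes "p * p = 1" "q * q = 1" "p * q = q * p" "p * Q = Q * p" "q * Q = - (Q * q)"
  defines "U \<equiv> (1/2) *\<^sub>R (1 + p + q - p * q)"
  shows "U * U = 1" and "U * Q * U = p * Q"
proof -
  \<comment> \<open>The assumptions are restated for right-nested products, so that rewriting brings
    every word to the order \<open>Q\<close>, \<open>p\<close>, \<open>q\<close>.\<close>
  have pp: "p * (p * x) = x" and qq: "q * (q * x) = x" and qp: "q * (p * x) = p * (q * x)"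
    and pQ: "p * (Q * x) = Q * (p * x)" and qQ: "q * (Q * x) = - (Q * (q * x))" for x
    using assms(1-5) by (simp_all flip: mult.assoc)
  note rules = ring_distribs mult.assoc assms(1,2,4,5) assms(3)[symmetric] pp qq qp pQ qQ
  have "(1 + p + q - p * q) * (1 + p + q - p * q) = 4 *\<^sub>R 1"
    by (simp add: rules scaleR_conv_of_real)
  then show UU: "U * U = 1"
    by (simp add: U_def)
  have "(1 + p + q - p * q) * Q = p * Q * (1 + p + q - p * q)"
    by (simp add: rules)
  then have "U * Q = p * Q * U"
    by (simp add: U_def)
  then show "U * Q * U = p * Q"
    using UU by (simp add: mult.assoc)
qed

lemma J12_eq: "J12 \<gamma> = cos (\<gamma> / 2) *\<^sub>R 1 + sin (\<gamma> / 2) *\<^sub>R (e 1 * e 5)"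
  using J_pair_eq[of 1 2] Id_gate_eq_1[of 3] by (simp add: J12_def)

lemma J23_eq: "J23 \<gamma> = cos (\<gamma> / 2) *\<^sub>R 1 + sin (\<gamma> / 2) *\<^sub>R (e 2 * e 6)"
  using J_pair_eq[of 2 3] Id_gate_eq_1[of 1] by (simp add: J23_def)

lemma J13_eq:
  "J13 \<gamma> = cos (\<gamma> / 2) *\<^sub>R 1 + sin (\<gamma> / 2) *\<^sub>R (iota 3 * (e 1 * e 5 * (e 2 * e 6)))"
proof -
  define p q Q where "p = iota 3 * (e 1 * e 5)" and "q = - (iota 3 * (e 4 * e 2))"
    and "Q = e 2 * e 6"
  have squares: "p * p = 1" "q * q = 1"
    using iota_pair_square[of 1 5 3] iota_pair_square[of 4 2 3] by (simp_all add: p_def q_def)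
  have iota: "(e 1 * e 5) * iota 3 = iota 3 * (e 1 * e 5)"
      "(e 4 * e 2) * iota 3 = iota 3 * (e 4 * e 2)" "Q * iota 3 = iota 3 * Q"
    unfolding Q_def by (rule iota_pair_commute[symmetric]; simp)+
  have pq: "p * q = q * p"
  proof -
    have "(e 4 * e 2) * p = p * (e 4 * e 2)"
      unfolding p_def using iota(2) by (rule commute_product) (rule e_pair_commute; simp)
    moreover have "iota 3 * p = p * iota 3"
      unfolding p_def by (rule commute_product[OF refl iota(1)[symmetric]])
    ultimately have "p * (iota 3 * (e 4 * e 2)) = iota 3 * (e 4 * e 2) * p"
      by (intro commute_product[OF sym sym])
    then show ?thesis
      by (simp add: q_def)
  qed
  have pQ: "p * Q = Q * p"
    unfolding p_def using iota(3)
    by (rule commute_product[symmetric]) (unfold Q_def, rule e_pair_commute; simp)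
  have qQ: "q * Q = - (Q * q)"
  proof -
    \<comment> \<open>The bivectors of \<open>q\<close> and \<open>Q\<close> share exactly one
      generator, \<open>e 2\<close>, and so anticommute. Its square cancels here and is reinserted
      below to rebuild the product in the reverse order.\<close>
    have "e 4 * e 2 * Q = e 4 * (e 2 * e 2) * e 6"
      by (simp add: Q_def mult.assoc)
    also have "\<dots> = - (e 6 * e 4)"
      using e_anticommute[of 4 6] by (simp add: e_square)
    also have "e 6 * e 4 = e 2 * (e 2 * (e 6 * e 4))"
      by (simp add: e_square flip: mult.assoc)
    also have "e 2 * (e 6 * e 4) = e 6 * e 4 * e 2"
      by (intro anticommute_product_commute e_anticommute) simp_all
    finally have "e 4 * e 2 * Q = - (Q * (e 4 * e 2))"
      by (simp add: Q_def mult.assoc)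
    then have "iota 3 * (e 4 * e 2) * Q = - (iota 3 * Q * (e 4 * e 2))"
      by (simp add: mult.assoc)
    also have "\<dots> = - (Q * (iota 3 * (e 4 * e 2)))"
      by (simp add: mult.assoc flip: iota(3))
    finally show ?thesis
      by (simp add: q_def)
  qed
  have swap: "SWAP12 * SWAP12 = 1" "SWAP12 * Q * SWAP12 = p * Q"
    unfolding SWAP12_eq[folded p_def q_def] by (rule conjugation_by_swap[OF squares pq pQ qQ])+
  have "J13 \<gamma> = SWAP12 * (cos (\<gamma> / 2) *\<^sub>R 1 + sin (\<gamma> / 2) *\<^sub>R Q) * SWAP12"
    using J_pair_eq[of 2 3] Id_gate_eq_1[of 1] by (simp add: J13_def Q_def)
  also have "\<dots> = cos (\<gamma> / 2) *\<^sub>R (SWAP12 * SWAP12) + sin (\<gamma> / 2) *\<^sub>R (SWAP12 * Q * SWAP12)"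
    by (simp add: ring_distribs)
  finally show ?thesis
    by (simp add: swap) (simp add: p_def Q_def mult.assoc)
qed

section \<open>Membership in the quantum register algebra\<close>

lemma geometric_algebra_closed:
  shows "1 \<in> geometric_algebra m"
    and "x \<in> geometric_algebra m \<Longrightarrow> y \<in> geometric_algebra m \<Longrightarrow> x + y \<in> geometric_algebra m"
    and "x \<in> geometric_algebra m \<Longrightarrow> y \<in> geometric_algebra m \<Longrightarrow> x * y \<in> geometric_algebra m"
    and "x \<in> geometric_algebra m \<Longrightarrow> c *\<^sub>R x \<in> geometric_algebra m"
    and "1 \<le> j \<Longrightarrow> j \<le> m \<Longrightarrow> e j \<in> geometric_algebra m"
  unfolding geometric_algebra_def by (auto intro: generated_subalgebra.intros)

lemma QRA_intro:
  assumes "x \<in> geometric_algebra (2 * n)" "y \<in> geometric_algebra (2 * n)"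
  shows "x + iota n * y \<in> QRA n"
proof -
  define c where "c k = (if k = 0 then 1 else iota n)" for k :: nat
  define g where "g k = (if k = 0 then x else y)" for k :: nat
  have "1 \<in> complex_scalars n" "iota n \<in> complex_scalars n"
    unfolding complex_scalars_def mem_Collect_eq
    by (rule exI[of _ 1], rule exI[of _ 0], simp, rule exI[of _ 0], rule exI[of _ 1], simp)
  then have "\<forall>k<2. c k \<in> complex_scalars n \<and> g k \<in> geometric_algebra (2 * n)"
    using assms by (simp add: c_def g_def)
  moreover have "x + iota n * y = (\<Sum>k<2. c k * g k)"
    by (simp add: c_def g_def numeral_2_eq_2)
  ultimately show ?thesis
    unfolding QRA_def by blast
qed

lemma geometric_algebra_subset_QRA: "geometric_algebra (2 * n) \<subseteq> QRA n"
proof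
  fix x assume x: "x \<in> geometric_algebra (2 * n)"
  show "x \<in> QRA n"
    \<comment> \<open>The \<open>iota\<close> part is zero, obtained as the multiple of
      \<open>x\<close> by 0.\<close>
    using QRA_intro[OF x geometric_algebra_closed(4)[OF x, of 0]] by simp
qed

text \<open>This suffices for \<open>J_hat2\<close>: \<open>J13\<close>, whose closed form contains
  \<open>iota 3\<close>, stands leftmost, and the other two gates lie in the geometric
  algebra.\<close>

lemma QRA_mult_right:
  assumes "z \<in> QRA n" "h \<in> geometric_algebra (2 * n)"
  shows "z * h \<in> QRA n"
proof -
  obtain m :: nat and c g where z: "z = (\<Sum>k<m. c k * g k)"
    and cg: "\<forall>k<m. c k \<in> complex_scalars n \<and> g k \<in> geometric_algebra (2 * n)"
    using assms(1) unfolding QRA_def by blast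
  have "z * h = (\<Sum>k<m. c k * (g k * h))"
    by (simp add: z sum_distrib_right mult.assoc)
  moreover have "\<forall>k<m. c k \<in> complex_scalars n \<and> g k * h \<in> geometric_algebra (2 * n)"
    using cg assms(2) geometric_algebra_closed(3) by blast
  ultimately show ?thesis
    unfolding QRA_def mem_Collect_eq
    by (intro exI[of _ m] exI[of _ c] exI[of _ "\<lambda>k. g k * h"] conjI)
qed

section \<open>Pairwise commutation of the gates\<close>

lemma affine_commute:
  fixes x y :: "'a::real_algebra_1"
  assumes "x * y = y * x"
  shows "(a *\<^sub>R 1 + b *\<^sub>R x) * (c *\<^sub>R 1 + d *\<^sub>R y) = (c *\<^sub>R 1 + d *\<^sub>R y) * (a *\<^sub>R 1 + b *\<^sub>R x)"
  using assms by (simp add: ring_distribs scaleR_add_right mult.commute add_ac)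

lemma gates_commute:
  shows "J12 \<alpha> * J23 \<beta> = J23 \<beta> * J12 \<alpha>"
    and "J12 \<alpha> * J13 \<beta> = J13 \<beta> * J12 \<alpha>"
    and "J23 \<alpha> * J13 \<beta> = J13 \<beta> * J23 \<alpha>"
proof -
  define E Q where "E = e 1 * e 5" and "Q = e 2 * e 6"
  have EQ: "E * Q = Q * E"
    unfolding E_def Q_def by (rule e_pair_commute) simp_all
  have "E * iota 3 = iota 3 * E" "Q * iota 3 = iota 3 * Q"
    using iota_pair_commute[of 1 3 5] iota_pair_commute[of 2 3 6] by (simp_all add: E_def Q_def)
  \<comment> \<open>The bivector of \<open>J13\<close> is built from \<open>iota 3\<close>,
    \<open>E\<close> and \<open>Q\<close>, which all commute with \<open>E\<close> and with
    \<open>Q\<close>.\<close>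
  then have "E * (iota 3 * (E * Q)) = iota 3 * (E * Q) * E"
    and "Q * (iota 3 * (E * Q)) = iota 3 * (E * Q) * Q"
    using EQ by (metis mult.assoc)+
  with EQ show "J12 \<alpha> * J23 \<beta> = J23 \<beta> * J12 \<alpha>" "J12 \<alpha> * J13 \<beta> = J13 \<beta> * J12 \<alpha>"
    "J23 \<alpha> * J13 \<beta> = J13 \<beta> * J23 \<alpha>"
    unfolding J12_eq J13_eq J23_eq E_def Q_def by (intro affine_commute; simp)+
qed

lemma
  shows J12_in_geometric_algebra: "J12 \<gamma> \<in> geometric_algebra (2 * 3)"
    and J23_in_geometric_algebra: "J23 \<gamma> \<in> geometric_algebra (2 * 3)"
  unfolding J12_eq J23_eq by (intro geometric_algebra_closed; simp)+

lemma J13_in_QRA: "J13 \<gamma> \<in> QRA 3"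
proof -
  have "cos (\<gamma> / 2) *\<^sub>R 1 + iota 3 * (sin (\<gamma> / 2) *\<^sub>R (e 1 * e 5 * (e 2 * e 6))) \<in> QRA 3"
    by (intro QRA_intro geometric_algebra_closed) simp_all
  then show ?thesis
    by (simp add: J13_eq)
qed

theorem mainTheorem1:
  fixes \<gamma>\<^sub>1\<^sub>2 \<gamma>\<^sub>1\<^sub>3 \<gamma>\<^sub>2\<^sub>3 :: real
  assumes "\<gamma>\<^sub>1\<^sub>2 \<in> {0..pi/2}" "\<gamma>\<^sub>1\<^sub>3 \<in> {0..pi/2}" "\<gamma>\<^sub>2\<^sub>3 \<in> {0..pi/2}"
  shows "J12 \<gamma>\<^sub>1\<^sub>2 \<in> QRA 3 \<and> J13 \<gamma>\<^sub>1\<^sub>3 \<in> QRA 3 \<and> J23 \<gamma>\<^sub>2\<^sub>3 \<in> QRA 3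
    \<and> J_hat2 \<gamma>\<^sub>1\<^sub>2 \<gamma>\<^sub>1\<^sub>3 \<gamma>\<^sub>2\<^sub>3 \<in> QRA 3
    \<and> J13 \<gamma>\<^sub>1\<^sub>3 * J23 \<gamma>\<^sub>2\<^sub>3 * J12 \<gamma>\<^sub>1\<^sub>2 = J_hat2 \<gamma>\<^sub>1\<^sub>2 \<gamma>\<^sub>1\<^sub>3 \<gamma>\<^sub>2\<^sub>3
    \<and> J13 \<gamma>\<^sub>1\<^sub>3 * J12 \<gamma>\<^sub>1\<^sub>2 * J23 \<gamma>\<^sub>2\<^sub>3 = J_hat2 \<gamma>\<^sub>1\<^sub>2 \<gamma>\<^sub>1\<^sub>3 \<gamma>\<^sub>2\<^sub>3
    \<and> J23 \<gamma>\<^sub>2\<^sub>3 * J13 \<gamma>\<^sub>1\<^sub>3 * J12 \<gamma>\<^sub>1\<^sub>2 = J_hat2 \<gamma>\<^sub>1\<^sub>2 \<gamma>\<^sub>1\<^sub>3 \<gamma>\<^sub>2\<^sub>3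
    \<and> J23 \<gamma>\<^sub>2\<^sub>3 * J12 \<gamma>\<^sub>1\<^sub>2 * J13 \<gamma>\<^sub>1\<^sub>3 = J_hat2 \<gamma>\<^sub>1\<^sub>2 \<gamma>\<^sub>1\<^sub>3 \<gamma>\<^sub>2\<^sub>3
    \<and> J12 \<gamma>\<^sub>1\<^sub>2 * J13 \<gamma>\<^sub>1\<^sub>3 * J23 \<gamma>\<^sub>2\<^sub>3 = J_hat2 \<gamma>\<^sub>1\<^sub>2 \<gamma>\<^sub>1\<^sub>3 \<gamma>\<^sub>2\<^sub>3
    \<and> J12 \<gamma>\<^sub>1\<^sub>2 * J23 \<gamma>\<^sub>2\<^sub>3 * J13 \<gamma>\<^sub>1\<^sub>3 = J_hat2 \<gamma>\<^sub>1\<^sub>2 \<gamma>\<^sub>1\<^sub>3 \<gamma>\<^sub>2\<^sub>3"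
proof -
  have "J12 \<gamma>\<^sub>1\<^sub>2 \<in> QRA 3" "J23 \<gamma>\<^sub>2\<^sub>3 \<in> QRA 3"
    using geometric_algebra_subset_QRA J12_in_geometric_algebra J23_in_geometric_algebra by blast+
  moreover have "J_hat2 \<gamma>\<^sub>1\<^sub>2 \<gamma>\<^sub>1\<^sub>3 \<gamma>\<^sub>2\<^sub>3 \<in> QRA 3"
    unfolding J_hat2_def
    by (intro QRA_mult_right J13_in_QRA J12_in_geometric_algebra J23_in_geometric_algebra)
  moreover note J13_in_QRA[of \<gamma>\<^sub>1\<^sub>3]
  \<comment> \<open>Adjacent transpositions of commuting factors reach all six orders.\<close>
  ultimately show ?thesis
    using gates_commute(1)[of \<gamma>\<^sub>1\<^sub>2 \<gamma>\<^sub>2\<^sub>3] gates_commute(2)[of \<gamma>\<^sub>1\<^sub>2 \<gamma>\<^sub>1\<^sub>3]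
      gates_commute(3)[of \<gamma>\<^sub>2\<^sub>3 \<gamma>\<^sub>1\<^sub>3]
    unfolding J_hat2_def by (metis mult.assoc)
qed

end
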